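(* Let $n$ be a positive integer and let $R$ be a unital ring with $n\in U(R)$. Let $\omega\in U(Z(R))$ satisfy $\omega^n=1$ and $\omega^i-\omega^j\in U(R)$ for all $i\neq j$, $0\leq i,j\leq n-1$. Suppose there exist $a,b\in R$ such that $u:=[a,b]$ satisfies $u^n=1$. If there exists $v\in U(R)$ such that $vuv^{-1}=\omega^{-1}u$, then there is an idempotent $e_0\in R$ such that $R\cong M_n(S)$ as rings, where $S=e_0Re_0$.
   Context: Rings are associative with identity $1$ and not necessarily commutative. $U(R)$ is the group of units of $R$, $Z(R)$ its center, and $[a,b]:=ab-ba$. "$n\in U(R)$" means that $n\cdot 1_R$ is a unit. For an idempotent $e_0$, $e_0Re_0$ is a unital ring with identity $e_0$. $M_n(S)$ is the ring of $n\times n$ matrices over $S$. *)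

theory Defs
  imports "HOL-Algebra.QuotRing" "Jordan_Normal_Form.Matrix"
begin

text \<open>
  Rings are records with an explicit carrier and are not assumed commutative. Type-class rings
  would not do, because the corner of a ring at an idempotent is not a type.
\<close>

definition ring_center :: "('a, 'b) ring_scheme \<Rightarrow> ('a, 'b) ring_scheme"
  where "ring_center R =
    R\<lparr>carrier := {z \<in> carrier R. \<forall>x \<in> carrier R. z \<otimes>\<^bsub>R\<^esub> x = x \<otimes>\<^bsub>R\<^esub> z}\<rparr>"

definition commutator :: "('a, 'b) ring_scheme \<Rightarrow> 'a \<Rightarrow> 'a \<Rightarrow> 'a"
  where "commutator R a b = (a \<otimes>\<^bsub>R\<^esub> b) \<ominus>\<^bsub>R\<^esub> (b \<otimes>\<^bsub>R\<^esub> a)"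

definition idempotent_elem :: "('a, 'b) ring_scheme \<Rightarrow> 'a \<Rightarrow> bool"
  where "idempotent_elem R e \<longleftrightarrow> e \<in> carrier R \<and> e \<otimes>\<^bsub>R\<^esub> e = e"

text \<open>The corner \<open>eRe\<close>; its identity is \<open>e\<close>, not the identity of \<open>R\<close>.\<close>

definition corner_ring :: "('a, 'b) ring_scheme \<Rightarrow> 'a \<Rightarrow> ('a, 'b) ring_scheme"
  where "corner_ring R e =
    R\<lparr>carrier := {e \<otimes>\<^bsub>R\<^esub> r \<otimes>\<^bsub>R\<^esub> e | r. r \<in> carrier R}, one := e\<rparr>"

text \<open>
  The ring of \<open>n \<times> n\<close> matrices over a carrier-based ring. The library matrix ring
  cannot be used here: it takes its operations from a type class on the entries. Only the
  matrix type is taken over.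
\<close>

definition matrix_ring :: "nat \<Rightarrow> ('a, 'b) ring_scheme \<Rightarrow> 'a mat ring"
  where "matrix_ring n S = \<lparr>
    carrier = {A \<in> carrier_mat n n. \<forall>i < n. \<forall>j < n. A $$ (i, j) \<in> carrier S},
    monoid.mult = (\<lambda>A B. mat n n (\<lambda>(i, j). \<Oplus>\<^bsub>S\<^esub>k \<in> {..<n}. A $$ (i, k) \<otimes>\<^bsub>S\<^esub> B $$ (k, j))),
    one = mat n n (\<lambda>(i, j). if i = j then \<one>\<^bsub>S\<^esub> else \<zero>\<^bsub>S\<^esub>),
    zero = mat n n (\<lambda>(i, j). \<zero>\<^bsub>S\<^esub>),
    add = (\<lambda>A B. mat n n (\<lambda>(i, j). A $$ (i, j) \<oplus>\<^bsub>S\<^esub> B $$ (i, j)))\<rparr>"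

end

theory Submission
  imports Defs "HOL-Algebra.Multiplicative_Group"
begin

text \<open>
  The eigenprojections \<open>e\<^sub>i = n\<^sup>-\<^sup>1 \<Sum>\<^sub>k \<omega>\<^sup>-\<^sup>i\<^sup>k u\<^sup>k\<close> of \<open>u\<close> are orthogonal with sum \<open>1\<close>: since
  \<open>u e\<^sub>i = \<omega>\<^sup>i e\<^sub>i = e\<^sub>i u\<close>, the unit \<open>\<omega>\<^sup>i - \<omega>\<^sup>j\<close> annihilates \<open>e\<^sub>i e\<^sub>j\<close>, and the sum collapses because
  the powers of a nontrivial power of \<open>\<omega>\<close> add up to zero. As \<open>e\<^sub>i = v\<^sup>i e\<^sub>0 v\<^sup>-\<^sup>i\<close>, the elements
  \<open>v\<^sup>i e\<^sub>0 v\<^sup>-\<^sup>j\<close> form a full system of matrix units.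
\<close>

section \<open>Finite sums in abelian monoids\<close>

lemma (in abelian_monoid) finsum_swap:
  assumes "finite A" "finite B" "\<And>i j. i \<in> A \<Longrightarrow> j \<in> B \<Longrightarrow> f i j \<in> carrier G"
  shows "(\<Oplus>i\<in>A. \<Oplus>j\<in>B. f i j) = (\<Oplus>j\<in>B. \<Oplus>i\<in>A. f i j)"
  using assms(1,3)
proof (induct A)
  case empty
  then show ?case by (simp add: finsum_zero)
next
  case (insert a A)
  have "(\<Oplus>i\<in>insert a A. \<Oplus>j\<in>B. f i j) = (\<Oplus>j\<in>B. f a j) \<oplus> (\<Oplus>j\<in>B. \<Oplus>i\<in>A. f i j)"
    using insert by (simp add: Pi_def)
  also have "\<dots> = (\<Oplus>j\<in>B. f a j \<oplus> (\<Oplus>i\<in>A. f i j))"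
    using insert by (subst finsum_addf) (auto intro!: finsum_closed)
  also have "\<dots> = (\<Oplus>j\<in>B. \<Oplus>i\<in>insert a A. f i j)"
    using insert by (intro finsum_cong') (auto simp: Pi_def intro!: finsum_closed)
  finally show ?case .
qed

text \<open>Variant of \<open>finsum_singleton\<close> in which the shape of the summands is a
  premise, so that sums collapsing by orthogonality relations fit directly.\<close>

lemma (in abelian_monoid) finsum_single:
  assumes "finite A" "k \<in> A" "x \<in> carrier G" "\<And>i. i \<in> A \<Longrightarrow> f i = (if i = k then x else \<zero>)"
  shows "(\<Oplus>i\<in>A. f i) = x"
proof -
  have "(\<Oplus>i\<in>A. f i) = (\<Oplus>i\<in>A. if k = i then x else \<zero>)"
    using assms by (intro finsum_cong') auto
  also have "\<dots> = x"
    using assms finsum_singleton[of k A "\<lambda>_. x"] by simp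
  finally show ?thesis .
qed

context ring
begin

section \<open>Corner rings and recognition of matrix rings from matrix units\<close>

lemma corner_ringD:
  assumes "idempotent_elem R e" "x \<in> carrier (corner_ring R e)"
  shows "x \<in> carrier R" "e \<otimes> x = x" "x \<otimes> e = x"
proof -
  have e: "e \<in> carrier R" "e \<otimes> e = e"
    using assms(1) by (auto simp: idempotent_elem_def)
  obtain r where r: "r \<in> carrier R" "x = e \<otimes> r \<otimes> e"
    using assms(2) by (auto simp: corner_ring_def)
  show "x \<in> carrier R" using e r by simp
  have "e \<otimes> x = (e \<otimes> e) \<otimes> r \<otimes> e"
    using e(1) r by (simp add: m_assoc)
  then show "e \<otimes> x = x" using e r by simp
  show "x \<otimes> e = x" using e r by (simp add: m_assoc)
qed

text \<open>With \<open>corner_ringD\<close> this describes the corner as the elements fixed by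
  \<open>e\<close> on both sides. Such an \<open>x\<close> is its own witness, since
  \<open>e x e = x\<close>.\<close>

lemma corner_ringI:
  assumes "x \<in> carrier R" "e \<in> carrier R" "e \<otimes> x = x" "x \<otimes> e = x"
  shows "x \<in> carrier (corner_ring R e)"
  unfolding corner_ring_def using assms by (auto intro!: exI[of _ x])

text \<open>Both sums fold the same addition from the same zero, so induction on \<open>A\<close>
  applies. Unfolding \<open>finsum\<close> in the corner requires an abelian monoid there, which is
  established first.\<close>

lemma finsum_corner_ring:
  assumes e: "idempotent_elem R e"
    and "finite A" "\<And>i. i \<in> A \<Longrightarrow> f i \<in> carrier (corner_ring R e)"
  shows "finsum (corner_ring R e) f A = finsum R f A"
proof -
  let ?C = "corner_ring R e"
  have eR: "e \<in> carrier R" using e by (simp add: idempotent_elem_def)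
  note CD = corner_ringD[OF e]
  have ops: "\<zero>\<^bsub>?C\<^esub> = \<zero>" "x \<oplus>\<^bsub>?C\<^esub> y = x \<oplus> y" for x y
    by (simp_all add: corner_ring_def)
  interpret C: abelian_monoid ?C
  proof (rule abelian_monoidI, unfold ops)
    fix x y assume "x \<in> carrier ?C" "y \<in> carrier ?C"
    then show "x \<oplus> y \<in> carrier ?C"
      using eR by (intro corner_ringI) (auto simp: CD r_distr l_distr)
  qed (auto simp: a_ac CD eR intro!: corner_ringI)
  show ?thesis
    using assms(2,3)
  proof (induct A)
    case (insert a A)
    then have "f a \<in> carrier R" "f \<in> A \<rightarrow> carrier R" "f \<in> A \<rightarrow> carrier ?C"
      by (auto intro: CD(1))
    with insert show ?case by (simp add: ops(2))
  qed (simp add: ops(1))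
qed

text \<open>The products \<open>p i \<otimes> q j\<close> are matrix units in factored form. In
  module terms, the row of the \<open>p i\<close> and the column of the \<open>q i\<close> are
  mutually inverse maps between \<open>(eR)^n\<close> and \<open>R\<close>, so
  \<open>R = End(R)\<close> becomes \<open>End((eR)^n) = M_n(eRe)\<close>. Explicitly,
  \<open>r\<close> goes to the matrix with entries
  \<open>q i \<otimes> r \<otimes> p j\<close>.\<close>

lemma ring_iso_matrix_ring_corner:
  assumes e: "idempotent_elem R e"
    and p: "\<And>i. i < n \<Longrightarrow> p i \<in> carrier R" "\<And>i. i < n \<Longrightarrow> p i \<otimes> e = p i"
    and q: "\<And>i. i < n \<Longrightarrow> q i \<in> carrier R" "\<And>i. i < n \<Longrightarrow> e \<otimes> q i = q i"
    and qp: "\<And>i j. i < n \<Longrightarrow> j < n \<Longrightarrow> q i \<otimes> p j = (if i = j then e else \<zero>)"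
    and pq: "(\<Oplus>i\<in>{..<n}. p i \<otimes> q i) = \<one>"
  shows "R \<simeq> matrix_ring n (corner_ring R e)"
proof -
  let ?C = "corner_ring R e" and ?I = "{..<n}"
  define h where "h r = mat n n (\<lambda>(i, j). q i \<otimes> r \<otimes> p j)" for r
  have eR: "e \<in> carrier R" using e by (simp add: idempotent_elem_def)
  have ops: "x \<otimes>\<^bsub>?C\<^esub> y = x \<otimes> y" for x y by (simp add: corner_ring_def)
  have entry: "q i \<otimes> r \<otimes> p j \<in> carrier ?C" if "i < n" "j < n" "r \<in> carrier R" for i j r
  proof (rule corner_ringI)
    have "e \<otimes> (q i \<otimes> r \<otimes> p j) = (e \<otimes> q i) \<otimes> r \<otimes> p j"
      using that p(1) q(1) eR by (simp add: m_assoc)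
    then show "e \<otimes> (q i \<otimes> r \<otimes> p j) = q i \<otimes> r \<otimes> p j" using q(2) that by simp
    show "q i \<otimes> r \<otimes> p j \<otimes> e = q i \<otimes> r \<otimes> p j"
      using that p q(1) eR by (simp add: m_assoc)
  qed (use that p(1) q(1) eR in auto)
  \<comment> \<open>The two expansions insert the decomposition \<open>pq\<close> of
    \<open>\<one>\<close>; \<open>expand_r\<close> yields multiplicativity, and both together yield
    injectivity.\<close>
  have expand_l: "(\<Oplus>i\<in>?I. p i \<otimes> (q i \<otimes> x)) = x" if x: "x \<in> carrier R" for x
  proof -
    have "(\<Oplus>i\<in>?I. p i \<otimes> (q i \<otimes> x)) = (\<Oplus>i\<in>?I. p i \<otimes> q i \<otimes> x)"
      using p q x by (intro finsum_cong') (auto simp: m_assoc)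
    also have "\<dots> = (\<Oplus>i\<in>?I. p i \<otimes> q i) \<otimes> x"
      using p q x by (intro finsum_ldistr[symmetric]) auto
    finally show ?thesis using pq x by simp
  qed
  have expand_r: "(\<Oplus>i\<in>?I. x \<otimes> p i \<otimes> q i) = x" if x: "x \<in> carrier R" for x
  proof -
    have "(\<Oplus>i\<in>?I. x \<otimes> p i \<otimes> q i) = (\<Oplus>i\<in>?I. x \<otimes> (p i \<otimes> q i))"
      using p q x by (intro finsum_cong') (auto simp: m_assoc)
    also have "\<dots> = x \<otimes> (\<Oplus>i\<in>?I. p i \<otimes> q i)"
      using p q x by (intro finsum_rdistr[symmetric]) auto
    finally show ?thesis using pq x by simp
  qed
  \<comment> \<open>Conversely, \<open>qp\<close> lets \<open>q k\<close> and \<open>p l\<close>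
    read off a single coordinate, which yields surjectivity. The remaining factor \<open>e\<close>
    is absorbed once the coordinate lies in the corner.\<close>
  have select_l: "q k \<otimes> (\<Oplus>i\<in>?I. p i \<otimes> x i) = e \<otimes> x k"
    if k: "k < n" and x: "\<And>i. i < n \<Longrightarrow> x i \<in> carrier R" for k x
  proof -
    have "q k \<otimes> (\<Oplus>i\<in>?I. p i \<otimes> x i) = (\<Oplus>i\<in>?I. q k \<otimes> (p i \<otimes> x i))"
      using p q x k by (intro finsum_rdistr) auto
    also have "\<dots> = e \<otimes> x k"
    proof (rule finsum_single)
      fix i assume i: "i \<in> ?I"
      then have "q k \<otimes> (p i \<otimes> x i) = (q k \<otimes> p i) \<otimes> x i"
        using p q x k by (simp add: m_assoc)
      then show "q k \<otimes> (p i \<otimes> x i) = (if i = k then e \<otimes> x k else \<zero>)"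
        using qp i k x by auto
    qed (use k x eR in auto)
    finally show ?thesis .
  qed
  have select_r: "(\<Oplus>j\<in>?I. x j \<otimes> q j) \<otimes> p l = x l \<otimes> e"
    if l: "l < n" and x: "\<And>i. i < n \<Longrightarrow> x i \<in> carrier R" for l x
  proof -
    have "(\<Oplus>j\<in>?I. x j \<otimes> q j) \<otimes> p l = (\<Oplus>j\<in>?I. x j \<otimes> q j \<otimes> p l)"
      using p q x l by (intro finsum_ldistr) auto
    also have "\<dots> = x l \<otimes> e"
      by (rule finsum_single[of _ l]) (use p q x l qp eR in \<open>auto simp: m_assoc\<close>)
    finally show ?thesis .
  qed
  have "h \<in> ring_iso R (matrix_ring n ?C)"
  proof (rule ring_iso_memI)
    fix r assume r: "r \<in> carrier R"
    show "h r \<in> carrier (matrix_ring n ?C)"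
      using entry r by (auto simp: h_def matrix_ring_def)
    fix s assume s: "s \<in> carrier R"
    have "q i \<otimes> (r \<otimes> s) \<otimes> p j = (\<Oplus>\<^bsub>?C\<^esub>k\<in>?I. h r $$ (i, k) \<otimes> h s $$ (k, j))"
      if ij: "i < n" "j < n" for i j
    proof -
      have "(\<Oplus>\<^bsub>?C\<^esub>k\<in>?I. h r $$ (i, k) \<otimes> h s $$ (k, j))
          = (\<Oplus>k\<in>?I. h r $$ (i, k) \<otimes> h s $$ (k, j))"
      proof (rule finsum_corner_ring[OF e])
        fix k assume "k \<in> ?I"
        \<comment> \<open>A product of two entries is again of the form
          \<open>q i \<otimes> _ \<otimes> p j\<close>, so \<open>entry\<close> covers it.\<close>
        then show "h r $$ (i, k) \<otimes> h s $$ (k, j) \<in> carrier ?C"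
          using entry[OF ij, of "r \<otimes> p k \<otimes> q k \<otimes> s"] p q r s ij by (simp add: h_def m_assoc)
      qed simp
      also have "\<dots> = (\<Oplus>k\<in>?I. q i \<otimes> r \<otimes> p k \<otimes> q k \<otimes> (s \<otimes> p j))"
        using p q r s ij by (intro finsum_cong') (auto simp: h_def m_assoc)
      also have "\<dots> = (\<Oplus>k\<in>?I. q i \<otimes> r \<otimes> p k \<otimes> q k) \<otimes> (s \<otimes> p j)"
        using p q r s ij by (intro finsum_ldistr[symmetric]) auto
      also have "\<dots> = q i \<otimes> r \<otimes> (s \<otimes> p j)"
        using expand_r[of "q i \<otimes> r"] q r ij by simp
      finally show ?thesis using p q r s ij by (simp add: m_assoc)
    qed
    then show "h (r \<otimes> s) = h r \<otimes>\<^bsub>matrix_ring n ?C\<^esub> h s"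
      by (auto simp: h_def[of "r \<otimes> s"] matrix_ring_def ops)
    show "h (r \<oplus> s) = h r \<oplus>\<^bsub>matrix_ring n ?C\<^esub> h s"
      using p q r s by (auto simp: h_def matrix_ring_def corner_ring_def l_distr r_distr)
  next
    show "h \<one> = \<one>\<^bsub>matrix_ring n ?C\<^esub>"
      using q p qp by (auto simp: h_def matrix_ring_def corner_ring_def)
  next
    show "bij_betw h (carrier R) (carrier (matrix_ring n ?C))"
    proof (rule bij_betw_imageI)
      show "inj_on h (carrier R)"
      proof (rule inj_onI)
        fix r s assume r: "r \<in> carrier R" and s: "s \<in> carrier R" and "h r = h s"
        then have eq: "q i \<otimes> r \<otimes> p j = q i \<otimes> s \<otimes> p j" if "i < n" "j < n" for i j
          using that by (auto simp: h_def mat_eq_iff)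
        \<comment> \<open>The right factors \<open>p j\<close> are removed by multiplying with
          \<open>q j\<close> and summing; afterwards the \<open>q i\<close> are removed in the same
          way on the left.\<close>
        have "q i \<otimes> r = q i \<otimes> s" if i: "i < n" for i
        proof -
          have "(\<Oplus>j\<in>?I. q i \<otimes> r \<otimes> p j \<otimes> q j) = (\<Oplus>j\<in>?I. q i \<otimes> s \<otimes> p j \<otimes> q j)"
            using eq i p q s by (intro finsum_cong') auto
          then show ?thesis using expand_r q i r s by simp
        qed
        then have "(\<Oplus>i\<in>?I. p i \<otimes> (q i \<otimes> r)) = (\<Oplus>i\<in>?I. p i \<otimes> (q i \<otimes> s))"
          using p q s by (intro finsum_cong') auto
        then show "r = s" using expand_l r s by simp
      qed
      show "h ` carrier R = carrier (matrix_ring n ?C)"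
      proof (intro equalityI subsetI)
        fix A assume "A \<in> carrier (matrix_ring n ?C)"
        then have A: "A \<in> carrier_mat n n" "\<And>i j. i < n \<Longrightarrow> j < n \<Longrightarrow> A $$ (i, j) \<in> carrier ?C"
          by (auto simp: matrix_ring_def)
        note AC = corner_ringD[OF e A(2)]
        \<comment> \<open>The preimage of \<open>A\<close> is the double sum of
          \<open>p i A_ij q j\<close>, split by rows so that \<open>select_l\<close> and then
          \<open>select_r\<close> apply.\<close>
        define row where "row i = (\<Oplus>j\<in>?I. A $$ (i, j) \<otimes> q j)" for i
        define r where "r = (\<Oplus>i\<in>?I. p i \<otimes> row i)"
        have row: "row i \<in> carrier R" if "i < n" for i
          unfolding row_def using that AC q by (intro finsum_closed) auto
        have r: "r \<in> carrier R"
          unfolding r_def using p row by (intro finsum_closed) auto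
        have "q k \<otimes> r \<otimes> p l = A $$ (k, l)" if "k < n" "l < n" for k l
        proof -
          have "q k \<otimes> r \<otimes> p l = e \<otimes> (row k \<otimes> p l)"
            unfolding r_def using select_l[of k row] row that eR p by (simp add: m_assoc)
          also have "row k \<otimes> p l = A $$ (k, l) \<otimes> e"
            unfolding row_def using AC that by (intro select_r) auto
          finally show ?thesis using AC that by simp
        qed
        then have "h r = A"
          using A(1) by (auto simp: h_def intro!: eq_matI)
        then show "A \<in> h ` carrier R" using r by blast
      qed (use entry in \<open>auto simp: h_def matrix_ring_def\<close>)
    qed
  qed
  then show ?thesis by (auto simp: is_ring_iso_def)
qed

section \<open>Geometric sums, central elements and conjugation\<close>

lemma geometric_sum_absorb:
  assumes y: "y \<in> carrier R" and "y [^] (n::nat) = \<one>"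
  shows "y \<otimes> (\<Oplus>k\<in>{..<n}. y [^] k) = (\<Oplus>k\<in>{..<n}. y [^] k)"
    and "(\<Oplus>k\<in>{..<n}. y [^] k) \<otimes> y = (\<Oplus>k\<in>{..<n}. y [^] k)"
proof -
  let ?S = "\<Oplus>k\<in>{..<n}. y [^] k"
  \<comment> \<open>Raising every exponent by one permutes the powers cyclically, as
    \<open>y^n = y^0\<close>. For \<open>n = Suc m\<close>, the sum of \<open>y^0\<close> to
    \<open>y^n\<close> is split at either end and \<open>\<one>\<close> is cancelled.\<close>
  have shift: "(\<Oplus>k\<in>{..<n}. y [^] Suc k) = ?S"
  proof (cases n)
    case (Suc m)
    have "(\<Oplus>k\<in>{..m}. y [^] Suc k) \<oplus> \<one> = (\<Oplus>k\<in>{..Suc m}. y [^] k)"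
      using y finsum_Suc2[of "\<lambda>k. y [^] k" m] by simp
    also have "\<dots> = y [^] n \<oplus> (\<Oplus>k\<in>{..m}. y [^] k)"
      using y Suc finsum_Suc[of "\<lambda>k. y [^] k" m] by simp
    also have "\<dots> = (\<Oplus>k\<in>{..m}. y [^] k) \<oplus> \<one>"
      using y assms(2) by (simp add: a_comm finsum_closed)
    finally have "(\<Oplus>k\<in>{..m}. y [^] Suc k) = (\<Oplus>k\<in>{..m}. y [^] k)"
      using y by (subst (asm) add.right_cancel) (auto intro!: finsum_closed)
    then show ?thesis using Suc by (simp only: lessThan_Suc_atMost)
  qed simp
  have "?S \<otimes> y = (\<Oplus>k\<in>{..<n}. y [^] Suc k)"
    using y by (subst finsum_ldistr) auto
  then show "?S \<otimes> y = ?S" using shift by simp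
  have "y \<otimes> ?S = (\<Oplus>k\<in>{..<n}. y \<otimes> y [^] k)"
    using y by (subst finsum_rdistr) auto
  also have "\<dots> = (\<Oplus>k\<in>{..<n}. y [^] Suc k)"
    using y by (intro finsum_cong') (auto simp: group_commutes_pow[of y y])
  finally show "y \<otimes> ?S = ?S" using shift by simp
qed

lemma Units_mult_eq_zeroD:
  assumes "x \<in> Units R" "y \<in> carrier R" "x \<otimes> y = \<zero>"
  shows "y = \<zero>"
proof -
  have "y = inv x \<otimes> (x \<otimes> y)"
    using assms(1,2) Units_closed[OF assms(1)] by (simp add: m_assoc[symmetric])
  then show ?thesis using assms by simp
qed

text \<open>By absorption \<open>\<one> \<ominus> y\<close> annihilates the sum, and a unit can be
  cancelled.\<close>

lemma geometric_sum_eq_zero: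
  assumes "y \<in> carrier R" "y [^] (n::nat) = \<one>" "\<one> \<ominus> y \<in> Units R"
  shows "(\<Oplus>k\<in>{..<n}. y [^] k) = \<zero>"
proof -
  let ?S = "\<Oplus>k\<in>{..<n}. y [^] k"
  have S: "?S \<in> carrier R" using assms by (auto intro!: finsum_closed)
  have "(\<one> \<ominus> y) \<otimes> ?S = ?S \<ominus> y \<otimes> ?S"
    using assms S by (simp add: minus_eq l_distr l_minus)
  also have "\<dots> = \<zero>"
    using geometric_sum_absorb(1)[OF assms(1,2)] S by (simp add: r_neg minus_eq)
  finally show ?thesis using Units_mult_eq_zeroD assms(3) S by blast
qed

lemma central_inv:
  assumes "x \<in> Units R" "\<And>y. y \<in> carrier R \<Longrightarrow> x \<otimes> y = y \<otimes> x" "y \<in> carrier R"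
  shows "inv x \<otimes> y = y \<otimes> inv x"
proof -
  have x: "x \<in> carrier R" "inv x \<in> carrier R" using assms by auto
  have "inv x \<otimes> y = inv x \<otimes> (y \<otimes> x) \<otimes> inv x"
    using assms x by (simp add: m_assoc)
  also have "\<dots> = inv x \<otimes> (x \<otimes> y) \<otimes> inv x" using assms by simp
  also have "\<dots> = y \<otimes> inv x"
    using assms(1,3) x by (simp add: m_assoc[symmetric])
  finally show ?thesis .
qed

lemma central_pow:
  assumes "x \<in> carrier R" "\<And>y. y \<in> carrier R \<Longrightarrow> x \<otimes> y = y \<otimes> x" "y \<in> carrier R"
  shows "x [^] (k::nat) \<otimes> y = y \<otimes> x [^] k"
  using assms group_commutes_pow[of x y k] by simp

text \<open>Since \<open>w\<close> is central, \<open>(w^i u)^k = (w^k)^i u^k\<close>. After the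
  swap, each inner sum is thus a geometric sum in \<open>w^k\<close> times \<open>u^k\<close>; it
  vanishes unless \<open>k = 0\<close>, where it counts the \<open>n\<close> indices.\<close>

lemma finsum_geometric_sums:
  assumes w: "w \<in> carrier R" "\<And>y. y \<in> carrier R \<Longrightarrow> w \<otimes> y = y \<otimes> w" "w [^] (n::nat) = \<one>"
    and diff: "\<And>k. 0 < k \<Longrightarrow> k < n \<Longrightarrow> \<one> \<ominus> w [^] k \<in> Units R"
    and u: "u \<in> carrier R" and n: "n \<ge> 1"
  shows "(\<Oplus>i\<in>{..<n}. \<Oplus>k\<in>{..<n}. (w [^] i \<otimes> u) [^] k) = add_pow R n \<one>"
proof -
  have "(\<Oplus>i\<in>{..<n}. \<Oplus>k\<in>{..<n}. (w [^] i \<otimes> u) [^] k)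
      = (\<Oplus>k\<in>{..<n}. \<Oplus>i\<in>{..<n}. (w [^] i \<otimes> u) [^] k)"
    using w u by (intro finsum_swap) auto
  also have "\<dots> = add_pow R n \<one>"
  proof (rule finsum_single[of _ 0])
    fix k assume k: "k \<in> {..<n}"
    have pow: "(w [^] i \<otimes> u) [^] k = (w [^] k) [^] i \<otimes> u [^] k" for i :: nat
      using w u by (simp add: pow_mult_distrib central_pow nat_pow_pow mult.commute)
    have "(\<Oplus>i\<in>{..<n}. (w [^] i \<otimes> u) [^] k) = (\<Oplus>i\<in>{..<n}. (w [^] k) [^] i) \<otimes> u [^] k"
      unfolding pow using w u by (subst finsum_ldistr) auto
    also have "(\<Oplus>i\<in>{..<n}. (w [^] k) [^] i) = (if k = 0 then add_pow R n \<one> else \<zero>)"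
    proof (cases "k = 0")
      case True
      then show ?thesis
        using add.finprod_const[of \<one> "{..<n}"] by simp
    next
      case False
      have "(w [^] k) [^] n = \<one>"
        using w(1,3) by (metis nat_pow_pow mult.commute nat_pow_one)
      then have "(\<Oplus>i\<in>{..<n}. (w [^] k) [^] i) = \<zero>"
        using w diff False k by (intro geometric_sum_eq_zero) auto
      then show ?thesis using False by simp
    qed
    finally show "(\<Oplus>i\<in>{..<n}. (w [^] i \<otimes> u) [^] k) = (if k = 0 then add_pow R n \<one> else \<zero>)"
      using u by (cases "k = 0") auto
  qed (use n in auto)
  finally show ?thesis .
qed

text \<open>Each conjugation by \<open>v\<close> contributes one factor \<open>w\<close>, which is
  central and so passes through the later conjugations. The power \<open>k\<close> follows because
  conjugation is multiplicative.\<close>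

lemma conj_pow_twisted:
  assumes w: "w \<in> carrier R" "\<And>y. y \<in> carrier R \<Longrightarrow> w \<otimes> y = y \<otimes> w"
    and u: "u \<in> carrier R" and v: "v \<in> Units R" and vu: "v \<otimes> u \<otimes> inv v = w \<otimes> u"
  shows "v [^] (i::nat) \<otimes> u [^] (k::nat) \<otimes> inv v [^] i = (w [^] i \<otimes> u) [^] k"
proof -
  have vR: "v \<in> carrier R" "inv v \<in> carrier R" using v by auto
  have conj: "v [^] i \<otimes> u \<otimes> inv v [^] i = w [^] i \<otimes> u" for i :: nat
  proof (induct i)
    case (Suc i)
    have "v [^] Suc i \<otimes> u \<otimes> inv v [^] Suc i = v \<otimes> (v [^] i \<otimes> u \<otimes> inv v [^] i) \<otimes> inv v"
      using vR u by (subst nat_pow_Suc2[OF vR(1)]) (simp add: m_assoc)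
    also have "\<dots> = v \<otimes> (w [^] i \<otimes> u) \<otimes> inv v" using Suc by simp
    also have "\<dots> = v \<otimes> w [^] i \<otimes> u \<otimes> inv v"
      using vR w u by (simp add: m_assoc)
    also have "\<dots> = w [^] i \<otimes> (v \<otimes> u \<otimes> inv v)"
      using vR w u by (simp add: m_assoc central_pow[OF w vR(1), symmetric])
    also have "\<dots> = w [^] Suc i \<otimes> u"
      using vR w(1) u vu by (simp add: m_assoc)
    finally show ?case .
  qed (use u in simp)
  have inv_pow: "inv v [^] i \<otimes> v [^] i = \<one>" for i :: nat
    using v vR by (simp add: pow_mult_distrib[symmetric])
  show ?thesis
  proof (induct k)
    case 0
    show ?case using v vR by (simp add: pow_mult_distrib[symmetric])
  next
    case (Suc k)
    have "v [^] i \<otimes> u [^] Suc k \<otimes> inv v [^] i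
        = v [^] i \<otimes> u [^] k \<otimes> (inv v [^] i \<otimes> v [^] i) \<otimes> u \<otimes> inv v [^] i"
      using vR u inv_pow by (simp add: m_assoc)
    also have "\<dots> = (v [^] i \<otimes> u [^] k \<otimes> inv v [^] i) \<otimes> (v [^] i \<otimes> u \<otimes> inv v [^] i)"
      using vR u by (simp add: m_assoc)
    finally show ?case using Suc conj by simp
  qed
qed

text \<open>Evaluating \<open>x u y\<close> from either side gives \<open>s x y = t x y\<close>,
  where centrality moves \<open>t\<close> past \<open>x\<close>.\<close>

lemma eigenvectors_orthogonal:
  assumes "s \<in> carrier R" "t \<in> carrier R" "\<And>y. y \<in> carrier R \<Longrightarrow> t \<otimes> y = y \<otimes> t"
    and "u \<in> carrier R" "x \<in> carrier R" "y \<in> carrier R"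
    and "x \<otimes> u = s \<otimes> x" "u \<otimes> y = t \<otimes> y" "s \<ominus> t \<in> Units R"
  shows "x \<otimes> y = \<zero>"
proof -
  have "s \<otimes> (x \<otimes> y) = x \<otimes> (u \<otimes> y)"
    using assms(1,4-7) by (simp add: m_assoc[symmetric])
  also have "\<dots> = x \<otimes> t \<otimes> y"
    using assms(2,5,6,8) by (simp add: m_assoc)
  also have "\<dots> = t \<otimes> (x \<otimes> y)"
    unfolding assms(3)[OF assms(5), symmetric] using assms(2,5,6) by (simp add: m_assoc)
  finally have "(s \<ominus> t) \<otimes> (x \<otimes> y) = \<zero>"
    using assms(1,2,5,6) by (simp add: minus_eq l_distr l_minus r_neg)
  then show ?thesis using Units_mult_eq_zeroD assms by blast
qed

section \<open>Eigenprojections and their matrix units\<close>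

lemma ring_iso_matrix_ring_if_twisted:
  assumes n: "n \<ge> 1" and nU: "add_pow R n \<one> \<in> Units R"
    and z: "z \<in> Units R" "\<And>y. y \<in> carrier R \<Longrightarrow> z \<otimes> y = y \<otimes> z" "z [^] n = \<one>"
    and diff: "\<And>i j :: nat. i < n \<Longrightarrow> j < n \<Longrightarrow> i \<noteq> j \<Longrightarrow> z [^] i \<ominus> z [^] j \<in> Units R"
    and u: "u \<in> carrier R" "u [^] n = \<one>"
    and v: "v \<in> Units R" and vu: "v \<otimes> u \<otimes> inv v = inv z \<otimes> u"
  shows "\<exists>e. idempotent_elem R e \<and> R \<simeq> matrix_ring n (corner_ring R e)"
proof -
  let ?I = "{..<n}"
  define c w where "c = inv (add_pow R n \<one>)" and "w = inv z"
  have vR: "v \<in> carrier R" "inv v \<in> carrier R" using v by auto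
  have zR: "z \<in> carrier R" using z by auto
  have w: "w \<in> carrier R" "\<And>y. y \<in> carrier R \<Longrightarrow> w \<otimes> y = y \<otimes> w"
    using z central_inv by (auto simp: w_def)
  have zw: "z [^] i \<otimes> w [^] i = \<one>" for i :: nat
    using z zR w by (simp add: pow_mult_distrib[symmetric] w_def)
  have wn: "w [^] n = \<one>" using zw[of n] z w by simp
  have c: "c \<in> carrier R" "\<And>y. y \<in> carrier R \<Longrightarrow> c \<otimes> y = y \<otimes> c"
  proof -
    show "c \<in> carrier R" using nU by (simp add: c_def)
    fix y assume "y \<in> carrier R"
    then show "c \<otimes> y = y \<otimes> c"
      unfolding c_def using nU
      by (intro central_inv) (auto simp: add_pow_ldistr add_pow_rdistr)
  qed
  have diff': "\<one> \<ominus> w [^] k \<in> Units R" if "0 < k" "k < n" for k :: nat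
  proof -
    \<comment> \<open>The hypothesis concerns differences of powers of \<open>z\<close>; the pair
      \<open>(k, 0)\<close> and the unit factor \<open>w^k\<close> transfer it to
      \<open>w\<close>.\<close>
    have "\<one> \<ominus> w [^] k = (z [^] k \<ominus> z [^] (0::nat)) \<otimes> w [^] k"
      using zR w(1) zw[of k] by (simp add: minus_eq l_distr l_minus)
    moreover have "w [^] k \<in> Units R"
      using z by (simp add: w_def Units_pow_closed)
    ultimately show ?thesis using diff[of k 0] that by simp
  qed
  \<comment> \<open>The coefficients \<open>w^(ik)\<close> are absorbed into the base, making each
    projection a geometric sum in an element whose \<open>n\<close>-th power is
    \<open>\<one>\<close>.\<close>
  define E where "E i = c \<otimes> (\<Oplus>k\<in>?I. (w [^] i \<otimes> u) [^] k)" for i :: nat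
  have ER: "E i \<in> carrier R" for i
    unfolding E_def using c w u by (auto intro!: finsum_closed)
  have sum_E: "(\<Oplus>i\<in>?I. E i) = \<one>"
  proof -
    have "(\<Oplus>i\<in>?I. E i) = c \<otimes> (\<Oplus>i\<in>?I. \<Oplus>k\<in>?I. (w [^] i \<otimes> u) [^] k)"
      unfolding E_def using c w u by (intro finsum_rdistr[symmetric]) (auto intro!: finsum_closed)
    also have "\<dots> = \<one>"
      using finsum_geometric_sums[OF w wn diff' u(1) n] nU by (simp add: c_def)
    finally show ?thesis .
  qed
  have eigen: "u \<otimes> E i = z [^] i \<otimes> E i" "E i \<otimes> u = z [^] i \<otimes> E i" for i
  proof -
    \<comment> \<open>By absorption \<open>x\<close> fixes \<open>E i\<close> on both sides, and
      \<open>u = z^i x\<close> then gives the eigenvalue \<open>z^i\<close>.\<close>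
    define x S where "x = w [^] i \<otimes> u" and "S = (\<Oplus>k\<in>?I. x [^] k)"
    have x: "x \<in> carrier R" using w u by (simp add: x_def)
    have S: "S \<in> carrier R" using x by (auto simp: S_def intro!: finsum_closed)
    have "x [^] n = (w [^] n) [^] i \<otimes> u [^] n"
      unfolding x_def using w u by (simp add: pow_mult_distrib central_pow nat_pow_pow mult.commute)
    then have "x [^] n = \<one>" using wn u by simp
    note xS = geometric_sum_absorb[OF x this, folded S_def]
    have E: "E i = c \<otimes> S" by (simp add: E_def S_def x_def)
    have ux: "u = z [^] i \<otimes> x"
      using zR w u zw[of i] by (simp add: x_def m_assoc[symmetric])
    have zi: "z [^] i \<otimes> y = y \<otimes> z [^] i" if "y \<in> carrier R" for y
      using central_pow[OF zR z(2) that] .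
    have "x \<otimes> E i = c \<otimes> (x \<otimes> S)"
      using c(1) c(2)[OF x] x S by (simp add: E m_assoc[symmetric])
    then have "x \<otimes> E i = E i" using xS E by simp
    then show "u \<otimes> E i = z [^] i \<otimes> E i"
      using ux zR x ER[of i] by (simp add: m_assoc)
    have "E i \<otimes> x = E i" using xS c(1) S x by (simp add: E m_assoc)
    moreover have "E i \<otimes> u = z [^] i \<otimes> (E i \<otimes> x)"
      using ux zR x ER[of i] zi[OF ER[of i]] by (simp add: m_assoc[symmetric])
    ultimately show "E i \<otimes> u = z [^] i \<otimes> E i" by simp
  qed
  have orth: "E i \<otimes> E j = \<zero>" if "i < n" "j < n" "i \<noteq> j" for i j
    using that zR u ER eigen diff central_pow[OF zR z(2)]
    by (intro eigenvectors_orthogonal[of "z [^] i" "z [^] j" u]) auto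
  have idem: "E i \<otimes> E i = E i" if i: "i < n" for i
  proof -
    \<comment> \<open>Idempotence comes from multiplying the decomposition of \<open>\<one>\<close>
      by \<open>E i\<close> and applying orthogonality.\<close>
    have "E i = E i \<otimes> (\<Oplus>j\<in>?I. E j)" using sum_E ER by simp
    also have "\<dots> = (\<Oplus>j\<in>?I. E i \<otimes> E j)" using ER by (intro finsum_rdistr) auto
    also have "\<dots> = E i \<otimes> E i"
      using i ER orth by (intro finsum_single[of _ i]) auto
    finally show ?thesis by simp
  qed
  have vinv: "v [^] i \<otimes> inv v [^] i = \<one>" "inv v [^] i \<otimes> v [^] i = \<one>" for i :: nat
    using v vR by (auto simp: pow_mult_distrib[symmetric])
  have conj_E: "v [^] i \<otimes> E 0 \<otimes> inv v [^] i = E i" for i :: nat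
  proof -
    let ?V = "v [^] i" and ?V' = "inv v [^] i"
    let ?S = "\<Oplus>k\<in>?I. u [^] k"
    have S: "?S \<in> carrier R" using u by (auto intro!: finsum_closed)
    \<comment> \<open>For index \<open>0\<close> the twist \<open>w^0\<close> is trivial, so
      conjugating the plain powers of \<open>u\<close> termwise produces the twisted ones.\<close>
    have E0: "E 0 = c \<otimes> ?S" using u by (simp add: E_def)
    have "?V \<otimes> E 0 \<otimes> ?V' = ?V \<otimes> c \<otimes> ?S \<otimes> ?V'"
      using c(1) vR S E0 by (simp add: m_assoc)
    also have "\<dots> = c \<otimes> (?V \<otimes> ?S \<otimes> ?V')"
      unfolding c(2)[OF nat_pow_closed[OF vR(1)], symmetric]
      using c(1) vR S by (simp add: m_assoc)
    also have "?V \<otimes> ?S \<otimes> ?V' = (\<Oplus>k\<in>?I. ?V \<otimes> u [^] k \<otimes> ?V')"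
      using vR u by (subst finsum_rdistr, simp, simp, simp, subst finsum_ldistr) auto
    also have "\<dots> = (\<Oplus>k\<in>?I. (w [^] i \<otimes> u) [^] k)"
      using conj_pow_twisted[OF w u(1) v vu[folded w_def]] by simp
    finally show ?thesis by (simp add: E_def)
  qed
  have e: "idempotent_elem R (E 0)"
    using ER idem n by (simp add: idempotent_elem_def)
  have "R \<simeq> matrix_ring n (corner_ring R (E 0))"
  proof (rule ring_iso_matrix_ring_corner
      [where p = "\<lambda>i. v [^] i \<otimes> E 0" and q = "\<lambda>i. E 0 \<otimes> inv v [^] i"])
    have ee: "E 0 \<otimes> E 0 = E 0" using idem n by simp
    show "v [^] i \<otimes> E 0 \<otimes> E 0 = v [^] i \<otimes> E 0" for i :: nat
      using vR ER ee by (simp add: m_assoc)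
    show "E 0 \<otimes> (E 0 \<otimes> inv v [^] i) = E 0 \<otimes> inv v [^] i" for i :: nat
      using vR ER ee by (simp add: m_assoc[symmetric])
    have "v [^] i \<otimes> E 0 \<otimes> (E 0 \<otimes> inv v [^] i) = E i" for i :: nat
    proof -
      have "v [^] i \<otimes> E 0 \<otimes> (E 0 \<otimes> inv v [^] i) = v [^] i \<otimes> (E 0 \<otimes> E 0) \<otimes> inv v [^] i"
        using vR ER[of 0] by (simp add: m_assoc)
      then show ?thesis using ee conj_E by simp
    qed
    then show "(\<Oplus>i\<in>?I. v [^] i \<otimes> E 0 \<otimes> (E 0 \<otimes> inv v [^] i)) = \<one>"
      using sum_E by simp
    fix i j assume ij: "i < n" "j < n"
    \<comment> \<open>Moving the powers of \<open>v\<close> outward turns the two copies of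
      \<open>E 0\<close> into \<open>E i\<close> and \<open>E j\<close>, so orthogonality handles
      \<open>i \<noteq> j\<close>.\<close>
    have l: "E 0 \<otimes> inv v [^] i = inv v [^] i \<otimes> E i" for i :: nat
    proof -
      have "inv v [^] i \<otimes> E i = (inv v [^] i \<otimes> v [^] i) \<otimes> E 0 \<otimes> inv v [^] i"
        using vR ER[of 0] by (simp add: m_assoc conj_E[of i, symmetric])
      then show ?thesis using vinv ER[of 0] by simp
    qed
    have r: "v [^] j \<otimes> E 0 = E j \<otimes> v [^] j" for j :: nat
    proof -
      have "E j \<otimes> v [^] j = v [^] j \<otimes> E 0 \<otimes> (inv v [^] j \<otimes> v [^] j)"
        using vR ER[of 0] by (simp add: m_assoc conj_E[of j, symmetric])
      then show ?thesis using vinv ER[of 0] vR by simp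
    qed
    show "E 0 \<otimes> inv v [^] i \<otimes> (v [^] j \<otimes> E 0) = (if i = j then E 0 else \<zero>)"
    proof (cases "i = j")
      case True
      have "E 0 \<otimes> inv v [^] i \<otimes> (v [^] i \<otimes> E 0) = E 0 \<otimes> (inv v [^] i \<otimes> v [^] i) \<otimes> E 0"
        using vR ER[of 0] by (simp add: m_assoc)
      then show ?thesis using True vinv ee ER[of 0] by simp
    next
      case False
      have "E 0 \<otimes> inv v [^] i \<otimes> (v [^] j \<otimes> E 0) = inv v [^] i \<otimes> (E i \<otimes> E j) \<otimes> v [^] j"
        unfolding l r using vR ER by (simp add: m_assoc)
      then show ?thesis using False orth ij vR by simp
    qed
  qed (use e vR ER in auto)
  with e show ?thesis by blast
qed

end

theorem theorem4p9:
  fixes R :: "('a, 'b) ring_scheme" (structure)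
    and n :: nat
    and \<omega> a b u v :: 'a
  assumes "ring R"
    and "n \<ge> 1"
    and "add_pow R n \<one> \<in> Units R"
    and "\<omega> \<in> Units (ring_center R)"
    and "\<omega> [^] n = \<one>"
    and "\<And>i j :: nat. i < n \<Longrightarrow> j < n \<Longrightarrow> i \<noteq> j \<Longrightarrow> (\<omega> [^] i) \<ominus> (\<omega> [^] j) \<in> Units R"
    and "a \<in> carrier R" and "b \<in> carrier R"
    and "u = commutator R a b"
    and "u [^] n = \<one>"
    and "v \<in> Units R"
    and "v \<otimes> u \<otimes> inv v = inv \<omega> \<otimes> u"
  shows "\<exists>e\<^sub>0. idempotent_elem R e\<^sub>0 \<and> R \<simeq> matrix_ring n (corner_ring R e\<^sub>0)"
proof -
  interpret ring R by fact
  \<comment> \<open>An inverse in the center is also an inverse in \<open>R\<close>.\<close>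
  have "\<omega> \<in> Units R" "\<And>y. y \<in> carrier R \<Longrightarrow> \<omega> \<otimes> y = y \<otimes> \<omega>"
    using assms(4) by (auto simp: Units_def ring_center_def)
  moreover have "u \<in> carrier R"
    using assms(7-9) by (simp add: commutator_def)
  ultimately show ?thesis
    using ring_iso_matrix_ring_if_twisted assms by blast
qed

end
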